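(* Let $F = (f_1,\ldots,f_n) \in \mathbb{Z}[X]^n$ and $\bm{x} = (x_1,\ldots,x_n) \in \mathbb{Z}^n$ be such that for each $1 \leq i \leq n$, $f_i$ is not linear nor a monomial, and $( f_i^m(x_i) )_{m \geq 1}$ is an unbounded rigid divisibility sequence. Then there is a constant $c>0$, depending only on $F$ and $\bm{x}$, such that $M_{F, \bm{x}}(N) \leq c\, N^n/\log N$ for all integers $N\ge 2$.
   Context: $f^m$ denotes the $m$-fold composition (iterate) of $f$. A monomial is a polynomial of the form $aX^d$. A vector $(\nu_1,\ldots,\nu_n)\in\mathbb{C}^n$ is multiplicatively dependent if all its entries are non-zero and there is a non-zero vector $(k_1,\ldots,k_n)\in\mathbb{Z}^n$ with $\nu_1^{k_1}\cdots\nu_n^{k_n}=1$ (a vector with a zero entry is neither multiplicatively dependent nor independent). For $N\in\mathbb{Z}^+$, $M_{F,\bm{x}}(N)$ denotes the number of $n$-tuples of integers $(m_1,\ldots,m_n)\in[1,N]^n$ such that $(f_1^{m_1}(x_1),\ldots,f_n^{m_n}(x_n))$ is multiplicatively dependent. A sequence $(a_n)_{n\ge1}$ of integers is a divisibility sequence if $a_m\mid a_n$ whenever $m\mid n$. It is a rigid divisibility sequence if additionally, for every prime $p$, there is an exponent $s_p$ such that for each $n\in\mathbb{Z}^+$, either $p\nmid a_n$ or $p^{s_p}\,\|\,a_n$ (i.e. $p^{s_p}\mid a_n$ and $p^{s_p+1}\nmid a_n$). *)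

theory Defs
  imports
    "HOL-Analysis.Analysis"
    "HOL-Computational_Algebra.Computational_Algebra"
begin

(* Vectors of length n are functions on the index set {1..n}; values outside it are irrelevant. *)

definition mult_dependent :: "nat \<Rightarrow> (nat \<Rightarrow> complex) \<Rightarrow> bool" where
  "mult_dependent n \<nu> \<longleftrightarrow>
     (\<forall>i\<in>{1..n}. \<nu> i \<noteq> 0) \<and>
     (\<exists>k :: nat \<Rightarrow> int. (\<exists>i\<in>{1..n}. k i \<noteq> 0) \<and> (\<Prod>i\<in>{1..n}. \<nu> i powi k i) = 1)"

definition orbit_val :: "int poly \<Rightarrow> int \<Rightarrow> nat \<Rightarrow> int" where
  "orbit_val f x m = (poly f ^^ m) x"

(* Extensional functions, so that each n-tuple in [1,N]^n is counted exactly once. *)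
definition M_count :: "nat \<Rightarrow> (nat \<Rightarrow> int poly) \<Rightarrow> (nat \<Rightarrow> int) \<Rightarrow> nat \<Rightarrow> nat" where
  "M_count n F x N =
     card {m \<in> {1..n} \<rightarrow>\<^sub>E {1..N}. mult_dependent n (\<lambda>i. of_int (orbit_val (F i) (x i) (m i)))}"

(* Sequences are indexed from 1; the value at 0 is ignored throughout. *)

definition divisibility_seq :: "(nat \<Rightarrow> int) \<Rightarrow> bool" where
  "divisibility_seq a \<longleftrightarrow> (\<forall>m\<ge>1. \<forall>n\<ge>1. m dvd n \<longrightarrow> a m dvd a n)"

definition rigid_divisibility_seq :: "(nat \<Rightarrow> int) \<Rightarrow> bool" where
  "rigid_divisibility_seq a \<longleftrightarrow>
     divisibility_seq a \<and>
     (\<forall>p::int. prime p \<longrightarrow>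
        (\<exists>s::nat. \<forall>n\<ge>1. \<not> p dvd a n \<or> (p ^ s dvd a n \<and> \<not> p ^ (s + 1) dvd a n)))"

definition unbounded_seq :: "(nat \<Rightarrow> int) \<Rightarrow> bool" where
  "unbounded_seq a \<longleftrightarrow> \<not> bounded (a ` {1..})"

definition is_monomial :: "int poly \<Rightarrow> bool" where
  "is_monomial f \<longleftrightarrow> (\<exists>a d. f = monom a d)"

end

(* If no prime of a_m = f^m(x) is new, rigidity makes each prime power exactly dividing a_m divide
   a_r for some r < m, and hence also f^(m-r)(0). One of r and m - r is at most m/2, so if 0 is not
   periodic, a_m divides the product of the a_h and f^h(0) with h <= m/2, which is far too small. If
   0 has period t, then a_m divides a_(m-t) up to a constant, which is again too small. Hence a_m
   has a primitive prime divisor for all large m, and these a_m are multiplicatively independent.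
   If the coordinates other than the j-th are fixed, only boundedly many m_j can occur with
   k_j nonzero, because the remaining coordinates span a group of rank at most n - 1. The count is
   therefore O(N^(n-1)). *)

theory Submission
  imports Defs
begin

section \<open>Iteration of polynomials and congruences\<close>

lemma orbit_val_add: "orbit_val f x (r + h) = orbit_val f (orbit_val f x r) h"
  unfolding orbit_val_def by (subst add.commute) (simp add: funpow_add)

lemma orbit_val_Suc: "orbit_val f x (Suc h) = poly f (orbit_val f x h)"
  by (simp add: orbit_val_def)

lemma dvd_poly_diff:
  fixes q :: "'a::comm_ring_1"
  assumes "q dvd y - z"
  shows "q dvd poly f y - poly f z"
proof (induction f)
  case (pCons c f)
  have "poly (pCons c f) y - poly (pCons c f) z =
      (y - z) * poly f y + z * (poly f y - poly f z)"
    by (simp add: algebra_simps)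
  with pCons assms show ?case by (simp add: dvd_mult2)
qed simp

text \<open>Integer polynomials preserve congruences, hence so do their iterates. With
  \<open>z = 0\<close> this compares an orbit passing through a multiple of \<open>q\<close> with
  the orbit of 0.\<close>

lemma dvd_orbit_val_diff:
  assumes "q dvd y - z"
  shows "q dvd orbit_val f y h - orbit_val f z h"
proof (induction h)
  case 0
  with assms show ?case by (simp add: orbit_val_def)
qed (simp add: orbit_val_Suc dvd_poly_diff)

text \<open>Only primes dividing \<open>a\<close> are tested; for each of them the absence of a
  primitive prime divisor will supply an earlier index to work with.\<close>

lemma dvd_if_prime_power_dvd:
  fixes a b :: int
  assumes "a \<noteq> 0" "b \<noteq> 0"
    and "\<And>p. prime p \<Longrightarrow> p dvd a \<Longrightarrow> p ^ multiplicity p a dvd b"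
  shows "a dvd b"
proof (rule multiplicity_le_imp_dvd[OF assms(1)])
  fix p :: int assume p: "prime p"
  show "multiplicity p a \<le> multiplicity p b"
  proof (cases "p dvd a")
    case True
    with p assms show ?thesis
      by (intro multiplicity_geI) auto
  qed (simp add: not_dvd_imp_multiplicity_0)
qed

section \<open>Rigidity and primitive prime divisors\<close>

text \<open>Earlier indices start at 1 because the value at 0 is the starting point of the orbit and
  not a term of the sequence.\<close>

definition primitive_prime_divisor :: "(nat \<Rightarrow> int) \<Rightarrow> nat \<Rightarrow> int \<Rightarrow> bool" where
  "primitive_prime_divisor a m p \<longleftrightarrow>
     prime p \<and> p dvd a m \<and> (\<forall>r\<in>{1..<m}. \<not> p dvd a r)"

lemma not_primitive_prime_divisorE:
  assumes "\<not> primitive_prime_divisor a m p" "prime p" "p dvd a m"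
  obtains r where "1 \<le> r" "r < m" "p dvd a r"
  using assms by (auto simp: primitive_prime_divisor_def)

text \<open>Every power of 2 divides 0, so a zero term would have no exact exponent at the prime
  2.\<close>

lemma rigid_divisibility_seq_nonzero:
  assumes "rigid_divisibility_seq a" "m \<ge> 1"
  shows "a m \<noteq> 0"
proof -
  have "prime (2::int)" by simp
  then obtain s :: nat where "\<not> (2::int) dvd a m \<or> \<not> 2 ^ (s + 1) dvd a m"
    using assms unfolding rigid_divisibility_seq_def by blast
  then show ?thesis by auto
qed

text \<open>One exponent serves all terms divisible by \<open>p\<close>, so \<open>a m\<close> and
  \<open>a r\<close> contain the same power of \<open>p\<close>.\<close>

lemma rigid_divisibility_seq_prime_power:
  assumes "rigid_divisibility_seq a" "prime p" "1 \<le> r" "p dvd a r" "1 \<le> m" "p dvd a m"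
  shows "p ^ multiplicity p (a m) dvd a r"
proof -
  obtain s :: nat
    where s: "\<And>n. n \<ge> 1 \<Longrightarrow> \<not> p dvd a n \<or> (p ^ s dvd a n \<and> \<not> p ^ (s + 1) dvd a n)"
    using assms(1,2) unfolding rigid_divisibility_seq_def by blast
  have "multiplicity p (a m) = s"
    using s[of m] assms by (intro multiplicity_eqI) auto
  then show ?thesis using s[of r] assms by auto
qed

text \<open>By rigidity the full \<open>p\<close>-part of the \<open>m\<close>-th term divides the
  \<open>r\<close>-th one. Modulo it, the last \<open>m - r\<close> steps start from 0, and they end
  at a multiple of it.\<close>

lemma rigid_orbit_prime_power:
  assumes rigid: "rigid_divisibility_seq (orbit_val f x)"
    and p: "prime p" "p dvd orbit_val f x r" "p dvd orbit_val f x m" and r: "1 \<le> r" "r < m"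
  shows "p ^ multiplicity p (orbit_val f x m) dvd orbit_val f 0 (m - r)"
proof -
  let ?q = "p ^ multiplicity p (orbit_val f x m)"
  have "?q dvd orbit_val f x r"
    using rigid_divisibility_seq_prime_power[OF rigid] p r by simp
  then have "?q dvd orbit_val f (orbit_val f x r) (m - r) - orbit_val f 0 (m - r)"
    by (intro dvd_orbit_val_diff) simp
  moreover have "orbit_val f (orbit_val f x r) (m - r) = orbit_val f x m"
    using r by (simp flip: orbit_val_add)
  moreover have "?q dvd orbit_val f x m" by (rule multiplicity_dvd)
  ultimately show ?thesis by (metis dvd_diff_right_iff)
qed

section \<open>Growth of orbits\<close>

text \<open>The length (l1 norm) of \<open>f\<close>; this one constant enters both the upper and
  the lower bounds.\<close>

definition coeff_norm :: "int poly \<Rightarrow> int" where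
  "coeff_norm f = (\<Sum>i\<le>degree f. \<bar>coeff f i\<bar>)"

lemma coeff_norm_pos:
  assumes "degree f \<noteq> 0"
  shows "coeff_norm f \<ge> 1"
proof -
  have "0 < \<bar>lead_coeff f\<bar>" using assms by auto
  then have "1 \<le> \<bar>lead_coeff f\<bar>" by linarith
  also have "\<dots> \<le> coeff_norm f"
    unfolding coeff_norm_def by (rule member_le_sum) auto
  finally show ?thesis .
qed

lemma poly_upper_bound:
  "max 1 \<bar>poly f y\<bar> \<le> max 1 (coeff_norm f) * max 1 \<bar>y\<bar> ^ degree f"
proof -
  let ?z = "max 1 \<bar>y\<bar>"
  have "\<bar>poly f y\<bar> \<le> (\<Sum>i\<le>degree f. \<bar>coeff f i * y ^ i\<bar>)"
    unfolding poly_altdef by (rule sum_abs)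
  also have "\<dots> \<le> (\<Sum>i\<le>degree f. \<bar>coeff f i\<bar> * ?z ^ degree f)"
  proof (rule sum_mono)
    fix i assume "i \<in> {..degree f}"
    then have "\<bar>y\<bar> ^ i \<le> ?z ^ i" "?z ^ i \<le> ?z ^ degree f"
      by (auto intro!: power_mono power_increasing)
    then show "\<bar>coeff f i * y ^ i\<bar> \<le> \<bar>coeff f i\<bar> * ?z ^ degree f"
      by (auto simp: abs_mult power_abs intro!: mult_left_mono)
  qed
  also have "\<dots> = coeff_norm f * ?z ^ degree f"
    by (simp add: coeff_norm_def sum_distrib_right)
  also have "\<dots> \<le> max 1 (coeff_norm f) * ?z ^ degree f"
    by (rule mult_right_mono) auto
  finally have "\<bar>poly f y\<bar> \<le> max 1 (coeff_norm f) * ?z ^ degree f" .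
  moreover have "1 * 1 \<le> max 1 (coeff_norm f) * ?z ^ degree f"
    by (rule mult_mono) auto
  ultimately show ?thesis by simp
qed

text \<open>A nonzero integer leading coefficient has absolute value at least 1, so the leading term
  dominates as soon as the argument exceeds the length of \<open>f\<close>.\<close>

lemma poly_lower_bound:
  assumes "degree f = Suc e" "1 \<le> \<bar>y\<bar>"
  shows "\<bar>y\<bar> ^ e * (\<bar>y\<bar> - coeff_norm f) \<le> \<bar>poly f y\<bar>"
proof -
  let ?l = "lead_coeff f"
  have "\<bar>\<Sum>i\<le>e. coeff f i * y ^ i\<bar> \<le> (\<Sum>i\<le>e. \<bar>coeff f i * y ^ i\<bar>)"
    by (rule sum_abs)
  also have "\<dots> \<le> (\<Sum>i\<le>e. \<bar>coeff f i\<bar> * \<bar>y\<bar> ^ e)"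
  proof (rule sum_mono)
    fix i assume "i \<in> {..e}"
    then have "\<bar>y\<bar> ^ i \<le> \<bar>y\<bar> ^ e"
      using assms by (auto intro!: power_increasing)
    then show "\<bar>coeff f i * y ^ i\<bar> \<le> \<bar>coeff f i\<bar> * \<bar>y\<bar> ^ e"
      by (auto simp: abs_mult power_abs intro!: mult_left_mono)
  qed
  also have "\<dots> \<le> coeff_norm f * \<bar>y\<bar> ^ e"
    by (simp add: coeff_norm_def assms(1) sum_distrib_right[symmetric] mult_right_mono)
  finally have tail: "\<bar>\<Sum>i\<le>e. coeff f i * y ^ i\<bar> \<le> coeff_norm f * \<bar>y\<bar> ^ e" .
  have "f \<noteq> 0" using assms(1) by auto
  then have "0 < \<bar>?l\<bar>" by simp
  then have "1 \<le> \<bar>?l\<bar>" by linarith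
  then have "1 * (\<bar>y\<bar> ^ e * \<bar>y\<bar>) \<le> \<bar>?l\<bar> * (\<bar>y\<bar> ^ e * \<bar>y\<bar>)"
    by (rule mult_right_mono) simp
  also have "\<dots> = \<bar>?l * y ^ Suc e\<bar>"
    by (simp add: abs_mult power_abs mult.commute)
  finally have head: "\<bar>y\<bar> ^ e * \<bar>y\<bar> \<le> \<bar>?l * y ^ Suc e\<bar>" by simp
  have "poly f y = (\<Sum>i\<le>e. coeff f i * y ^ i) + ?l * y ^ Suc e"
    by (simp add: poly_altdef assms(1))
  then have "\<bar>?l * y ^ Suc e\<bar> - \<bar>\<Sum>i\<le>e. coeff f i * y ^ i\<bar> \<le> \<bar>poly f y\<bar>"
    by linarith
  then show ?thesis using head tail by (simp add: algebra_simps)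
qed

text \<open>The induction carries an extra factor \<open>?C\<close> on the left. It is absorbed
  because \<open>?C ^ 2\<close> is at most \<open>?C ^ ?d\<close> for degree at least 2, so each
  step becomes a pure \<open>?d\<close>-th power.\<close>

lemma orbit_val_upper_bound:
  assumes "degree f \<ge> 2"
  shows "\<bar>orbit_val f y h\<bar> \<le> (coeff_norm f * max 1 \<bar>y\<bar>) ^ (degree f ^ h)"
proof -
  let ?C = "coeff_norm f" and ?d = "degree f"
  have C: "?C \<ge> 1" using coeff_norm_pos assms by simp
  have "?C * max 1 \<bar>orbit_val f y h\<bar> \<le> (?C * max 1 \<bar>y\<bar>) ^ (?d ^ h)"
  proof (induction h)
    case 0
    show ?case by (simp add: orbit_val_def)
  next
    case (Suc h)
    let ?z = "max 1 \<bar>orbit_val f y h\<bar>"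
    have "?C * max 1 \<bar>orbit_val f y (Suc h)\<bar> \<le> ?C * (?C * ?z ^ ?d)"
      using poly_upper_bound[of f "orbit_val f y h"] C
      by (intro mult_left_mono) (auto simp: orbit_val_Suc max_def)
    also have "\<dots> = ?C ^ 2 * ?z ^ ?d"
      by (simp add: power2_eq_square)
    also have "\<dots> \<le> ?C ^ ?d * ?z ^ ?d"
      using C assms by (intro mult_right_mono power_increasing) auto
    also have "\<dots> = (?C * ?z) ^ ?d"
      by (simp add: power_mult_distrib)
    also have "\<dots> \<le> ((?C * max 1 \<bar>y\<bar>) ^ (?d ^ h)) ^ ?d"
      using C Suc by (intro power_mono) auto
    finally show ?case by (simp add: mult.commute flip: power_mult)
  qed
  moreover have "1 * \<bar>orbit_val f y h\<bar> \<le> ?C * max 1 \<bar>orbit_val f y h\<bar>"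
    using C by (intro mult_mono) auto
  ultimately show ?thesis by linarith
qed

lemma unbounded_seq_large:
  assumes "unbounded_seq a"
  obtains m where "m \<ge> 1" "\<bar>a m\<bar> \<ge> B"
proof -
  have "\<exists>m\<ge>1. \<bar>a m\<bar> \<ge> B"
  proof (rule ccontr)
    assume no: "\<not> ?thesis"
    have less: "\<bar>a m\<bar> < B" if "m \<ge> 1" for m
      using no that by (metis not_le)
    have "a m \<in> {-B..B}" if "m \<ge> 1" for m
      using less[OF that] unfolding atLeastAtMost_iff by linarith
    then have "a ` {1..} \<subseteq> {-B..B}" by blast
    then have "finite (a ` {1..})" by (rule finite_subset) simp
    then have "finite (real_of_int ` a ` {1..})" by (rule finite_imageI)
    then have "bounded ((\<lambda>m. real_of_int (a m)) ` {1..})"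
      by (simp add: image_image finite_imp_bounded)
    with assms show False by (simp add: unbounded_seq_def)
  qed
  with that show ?thesis by blast
qed

text \<open>Together with the exclusion of linear polynomials this yields degree at least 2, on
  which the growth estimates rest.\<close>

lemma unbounded_orbit_degree_pos:
  assumes "unbounded_seq (orbit_val f x)"
  shows "degree f \<noteq> 0"
proof
  assume "degree f = 0"
  then obtain c where f: "f = [:c:]" by (rule degree_eq_zeroE)
  have "orbit_val f x m = c" if "m \<ge> 1" for m
    using that by (cases m) (auto simp: f orbit_val_Suc)
  moreover obtain m where m: "m \<ge> 1" "\<bar>orbit_val f x m\<bar> \<ge> \<bar>c\<bar> + 1"
    using unbounded_seq_large[OF assms] .
  ultimately have "orbit_val f x m = c" by simp
  with m show False by simp
qed

text \<open>Halving absorbs the factor lost in \<open>\<bar>f y\<bar> \<ge> \<bar>y\<bar> ^ d / 2\<close>, so that the iteration becomes a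
  clean power.\<close>

lemma orbit_val_lower_bound:
  assumes "degree f \<ge> 2" "unbounded_seq (orbit_val f x)"
  obtains m0 where "m0 \<ge> 1"
    "\<And>k. 2 ^ (degree f ^ k) < \<bar>orbit_val f x (m0 + k)\<bar>"
proof -
  let ?d = "degree f" and ?C = "coeff_norm f"
  \<comment> \<open>The summand \<open>2 * ?C\<close> makes the lower bound lose at most a factor 2;
    the summand 4 makes half the starting value at least 2, the base of the final power.\<close>
  define B where "B = 4 + 2 * ?C"
  have C: "?C \<ge> 1" using coeff_norm_pos assms by simp
  obtain e where e: "?d = Suc e" using assms(1) by (cases ?d) auto
  have step: "(real_of_int \<bar>y\<bar> / 2) ^ ?d \<le> real_of_int \<bar>poly f y\<bar> / 2" if "\<bar>y\<bar> \<ge> B" for y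
  proof -
    have "\<bar>y\<bar> ^ ?d \<le> 2 * (\<bar>y\<bar> ^ e * (\<bar>y\<bar> - ?C))"
    proof -
      have "\<bar>y\<bar> ^ e * \<bar>y\<bar> \<le> \<bar>y\<bar> ^ e * (2 * (\<bar>y\<bar> - ?C))"
        using that by (intro mult_left_mono) (auto simp: B_def)
      then show ?thesis by (simp add: e algebra_simps)
    qed
    also have "\<dots> \<le> 2 * \<bar>poly f y\<bar>"
      using poly_lower_bound[OF e, of y] that C by (simp add: B_def)
    finally have "real_of_int (\<bar>y\<bar> ^ ?d) \<le> real_of_int (2 * \<bar>poly f y\<bar>)"
      by (simp only: of_int_le_iff)
    then have "(real_of_int \<bar>y\<bar>) ^ ?d \<le> 2 * real_of_int \<bar>poly f y\<bar>" by simp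
    \<comment> \<open>Here degree at least 2 pays for the lost factor: halving the argument gains a
      factor of at least 4.\<close>
    moreover have "(2::real) ^ 2 \<le> 2 ^ ?d"
      using assms(1) by (intro power_increasing) auto
    then have "(real_of_int \<bar>y\<bar>) ^ ?d / 2 ^ ?d \<le> (real_of_int \<bar>y\<bar>) ^ ?d / 4"
      by (intro divide_left_mono) auto
    ultimately show ?thesis unfolding power_divide by linarith
  qed
  obtain m0 where m0: "m0 \<ge> 1" "\<bar>orbit_val f x m0\<bar> \<ge> B"
    using unbounded_seq_large[OF assms(2)] .
  let ?u = "\<lambda>m. real_of_int \<bar>orbit_val f x m\<bar> / 2"
  have up: "?u m0 ^ (?d ^ k) \<le> ?u (m0 + k)" for k
  proof (induction k)
    case (Suc k)
    have "1 \<le> ?u m0" using m0(2) C by (simp add: B_def)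
    then have "?u m0 ^ 1 \<le> ?u m0 ^ (?d ^ k)"
      using e by (intro power_increasing) auto
    then have "?u m0 \<le> ?u (m0 + k)" using Suc by simp
    then have "\<bar>orbit_val f x (m0 + k)\<bar> \<ge> B" using m0(2) by linarith
    from step[OF this] have "?u (m0 + k) ^ ?d \<le> ?u (m0 + Suc k)"
      by (simp add: orbit_val_Suc)
    moreover have "(?u m0 ^ (?d ^ k)) ^ ?d \<le> ?u (m0 + k) ^ ?d"
      using Suc by (intro power_mono) auto
    ultimately show ?case by (simp add: mult.commute flip: power_mult)
  qed simp
  have "2 ^ (?d ^ k) \<le> ?u m0 ^ (?d ^ k)" for k
    using m0(2) C by (intro power_mono) (auto simp: B_def)
  from this up have low: "2 ^ (?d ^ k) \<le> ?u (m0 + k)" for k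
    by (rule order_trans)
  have "2 ^ (?d ^ k) < \<bar>orbit_val f x (m0 + k)\<bar>" for k
  proof -
    have "(0::real) < 2 ^ (?d ^ k)" by simp
    then have "2 ^ (?d ^ k) < real_of_int \<bar>orbit_val f x (m0 + k)\<bar>"
      using low[of k] by linarith
    then have "real_of_int (2 ^ (?d ^ k)) < real_of_int \<bar>orbit_val f x (m0 + k)\<bar>" by simp
    then show ?thesis by (simp only: of_int_less_iff)
  qed
  with m0(1) that show ?thesis by blast
qed

text \<open>Beyond \<open>?C + K\<close> a single step multiplies the size by at least
  \<open>K\<close>. As \<open>K\<close> is at least 1, the orbit never falls below this threshold
  again.\<close>

lemma orbit_val_growth_factor:
  assumes "degree f \<ge> 2" "unbounded_seq (orbit_val f x)" "K \<ge> 1"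
  obtains m0 where "m0 \<ge> 1"
    "\<And>m. m \<ge> m0 \<Longrightarrow> K * \<bar>orbit_val f x m\<bar> \<le> \<bar>orbit_val f x (Suc m)\<bar>"
proof -
  let ?d = "degree f" and ?C = "coeff_norm f"
  have C: "?C \<ge> 1" using coeff_norm_pos assms by simp
  obtain e where e: "?d = Suc (Suc e)"
    using assms(1) by (cases ?d; cases "?d - 1") auto
  have grow: "K * \<bar>y\<bar> \<le> \<bar>poly f y\<bar>" if "\<bar>y\<bar> \<ge> ?C + K" for y
  proof -
    have "1 \<le> \<bar>y\<bar> ^ e" using that C assms(3) by (intro one_le_power) linarith
    then have "\<bar>y\<bar> \<le> \<bar>y\<bar> ^ Suc e" using mult_left_mono[of 1 "\<bar>y\<bar> ^ e" "\<bar>y\<bar>"] by simp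
    then have "\<bar>y\<bar> * K \<le> \<bar>y\<bar> ^ Suc e * (\<bar>y\<bar> - ?C)"
      using that assms(3) by (intro mult_mono) auto
    with poly_lower_bound[OF e, of y] that C assms(3) show ?thesis by (simp add: mult.commute)
  qed
  obtain m0 where m0: "m0 \<ge> 1" "\<bar>orbit_val f x m0\<bar> \<ge> ?C + K"
    using unbounded_seq_large[OF assms(2)] .
  have large: "\<bar>orbit_val f x m\<bar> \<ge> ?C + K" if "m \<ge> m0" for m
    using that
  proof (induction m rule: dec_induct)
    case (step m)
    have "1 * \<bar>orbit_val f x m\<bar> \<le> K * \<bar>orbit_val f x m\<bar>"
      using assms(3) by (intro mult_right_mono) auto
    with grow[OF step.IH] step.IH show ?case by (simp add: orbit_val_Suc)
  qed (rule m0)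
  show ?thesis
    using that[OF m0(1)] grow[OF large] by (simp add: orbit_val_Suc)
qed

section \<open>Existence of primitive prime divisors\<close>

lemma sum_power_le:
  fixes d :: nat
  assumes "d \<ge> 2"
  shows "(\<Sum>h=1..k. d ^ h) \<le> d ^ Suc k"
proof (induction k)
  case (Suc k)
  have "(\<Sum>h=1..Suc k. d ^ h) \<le> 2 * d ^ Suc k" using Suc by simp
  also have "\<dots> \<le> d * d ^ Suc k" using assms by (intro mult_right_mono) auto
  finally show ?case by simp
qed simp

text \<open>Without a primitive prime divisor \<open>?a m\<close> would divide the nonzero product
  \<open>P\<close>, whose logarithm has order at most \<open>?d ^ (m div 2)\<close>, whereas that of
  \<open>?a m\<close> grows like \<open>?d ^ m\<close>.\<close>

lemma primitive_prime_divisor_nonperiodic: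
  assumes d: "degree f \<ge> 2" and unb: "unbounded_seq (orbit_val f x)"
    and rigid: "rigid_divisibility_seq (orbit_val f x)"
    and nz: "\<And>h. h \<ge> 1 \<Longrightarrow> orbit_val f 0 h \<noteq> 0"
  obtains M where "\<And>m. m \<ge> M \<Longrightarrow> \<exists>p. primitive_prime_divisor (orbit_val f x) m p"
proof -
  let ?a = "orbit_val f x" and ?b = "orbit_val f 0" and ?d = "degree f"
  obtain m0 where m0: "m0 \<ge> 1" "\<And>k. 2 ^ (?d ^ k) < \<bar>?a (m0 + k)\<bar>"
    using orbit_val_lower_bound[OF d unb] by blast
  \<comment> \<open>The product of the bases that bound the orbits of \<open>x\<close> and of 0, so
    that \<open>K ^ (?d ^ h)\<close> bounds the \<open>h\<close>-th factor of \<open>P\<close>;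
    \<open>w\<close> then converts this to base 2.\<close>
  define K where "K = (coeff_norm f * max 1 \<bar>x\<bar>) * coeff_norm f"
  have K0: "K \<ge> 0" using coeff_norm_pos[of f] d by (auto simp: K_def)
  define w where "w = nat K"
  have "K \<le> 2 ^ w"
  proof -
    have "int w \<le> int (2 ^ w)" using less_exp[of w] by linarith
    then show ?thesis using K0 by (simp add: w_def)
  qed
  \<comment> \<open>The threshold is chosen so that \<open>w + Suc k\<close> is at most
    \<open>m - m0\<close> for \<open>k = m div 2\<close>.\<close>
  have "\<exists>p. primitive_prime_divisor ?a m p" if m: "m \<ge> 2 * (m0 + w + 1)" for m
  proof (rule ccontr)
    assume no: "\<not> ?thesis"
    define k where "k = m div 2"
    define P where "P = (\<Prod>h=1..k. ?a h * ?b h)"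
    have a0: "?a h \<noteq> 0" if "h \<ge> 1" for h
      using rigid_divisibility_seq_nonzero[OF rigid that] .
    have P0: "P \<noteq> 0" unfolding P_def using a0 nz by auto
    have "?a m dvd P"
    proof (rule dvd_if_prime_power_dvd)
      fix p :: int assume p: "prime p" "p dvd ?a m"
      let ?q = "p ^ multiplicity p (?a m)"
      have "\<not> primitive_prime_divisor ?a m p" using no by simp
      from this p obtain r where r: "1 \<le> r" "r < m" "p dvd ?a r"
        by (rule not_primitive_prime_divisorE)
      \<comment> \<open>Take \<open>h = r\<close> or \<open>h = m - r\<close>, whichever is at most
        half of \<open>m\<close>.\<close>
      obtain h where h: "h \<in> {1..k}" "?q dvd ?a h * ?b h"
      proof (cases "r \<le> k")
        case True
        have "?q dvd ?a r"
          using rigid_divisibility_seq_prime_power[OF rigid p(1) r(1,3) _ p(2)] r by simp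
        then show ?thesis using that[of r] r True by simp
      next
        case False
        have "?q dvd ?b (m - r)"
          using rigid_orbit_prime_power[OF rigid p(1) r(3) p(2) r(1,2)] .
        moreover have "m - r \<in> {1..k}" using r False by (auto simp: k_def)
        ultimately show ?thesis using that[of "m - r"] by simp
      qed
      have "?a h * ?b h dvd P" unfolding P_def using h by (intro dvd_prodI) auto
      with h(2) show "?q dvd P" by (rule dvd_trans)
    qed (use P0 a0 m in auto)
    then have "\<bar>?a m\<bar> \<le> \<bar>P\<bar>" using P0 by (simp add: dvd_imp_le_int)
    also have "\<dots> \<le> (\<Prod>h=1..k. K ^ (?d ^ h))"
      unfolding P_def abs_prod
    proof (rule prod_mono, safe)
      fix h
      have "\<bar>?a h\<bar> * \<bar>?b h\<bar> \<le> (coeff_norm f * max 1 \<bar>x\<bar>) ^ (?d ^ h) * coeff_norm f ^ (?d ^ h)"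
        using orbit_val_upper_bound[OF d, of x h] orbit_val_upper_bound[OF d, of 0 h]
        by (intro mult_mono) auto
      then show "\<bar>?a h * ?b h\<bar> \<le> K ^ (?d ^ h)"
        unfolding K_def by (simp add: abs_mult power_mult_distrib)
    qed simp
    also have "\<dots> = K ^ (\<Sum>h=1..k. ?d ^ h)" by (simp add: power_sum)
    also have "\<dots> \<le> (2 ^ w) ^ (\<Sum>h=1..k. ?d ^ h)"
      using \<open>K \<le> 2 ^ w\<close> K0 by (rule power_mono)
    also have "\<dots> = 2 ^ (w * (\<Sum>h=1..k. ?d ^ h))" by (simp add: power_mult)
    also have "\<dots> \<le> 2 ^ (?d ^ (m - m0))"
    proof (rule power_increasing)
      have "w \<le> 2 ^ w" using less_exp[of w] by linarith
      also have "\<dots> \<le> ?d ^ w" using d by (rule power_mono) simp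
      finally have "w * (\<Sum>h=1..k. ?d ^ h) \<le> ?d ^ w * ?d ^ Suc k"
        using sum_power_le[OF d] by (intro mult_mono) auto
      also have "\<dots> = ?d ^ (w + Suc k)" by (simp add: power_add)
      also have "\<dots> \<le> ?d ^ (m - m0)"
        using d m by (intro power_increasing) (auto simp: k_def)
      finally show "w * (\<Sum>h=1..k. ?d ^ h) \<le> ?d ^ (m - m0)" .
    qed simp
    also have "\<dots> < \<bar>?a m\<bar>" using m0(2)[of "m - m0"] m by simp
    finally show False by simp
  qed
  with that show ?thesis by blast
qed

text \<open>Now the orbit of 0 has only finitely many values. Prime powers coming from its nonzero
  values are collected in the constant \<open>D\<close>; all others divide the term one period
  earlier. So \<open>?a m\<close> would divide \<open>D * ?a (m - t)\<close>, against the
  growth.\<close>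

lemma primitive_prime_divisor_periodic:
  assumes d: "degree f \<ge> 2" and unb: "unbounded_seq (orbit_val f x)"
    and rigid: "rigid_divisibility_seq (orbit_val f x)"
    and per: "h0 \<ge> 1" "orbit_val f 0 h0 = 0"
  obtains M where "\<And>m. m \<ge> M \<Longrightarrow> \<exists>p. primitive_prime_divisor (orbit_val f x) m p"
proof -
  let ?a = "orbit_val f x" and ?b = "orbit_val f 0"
  define t where "t = (LEAST h. h \<ge> 1 \<and> ?b h = 0)"
  have t: "t \<ge> 1" "?b t = 0"
    using LeastI[of "\<lambda>h. h \<ge> 1 \<and> ?b h = 0" h0] per by (auto simp: t_def)
  have t_least: "t \<le> h" if "h \<ge> 1" "?b h = 0" for h
    unfolding t_def using that by (intro Least_le) auto
  define D where "D = (\<Prod>i\<in>{1..<t}. ?b i)"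
  have D0: "D \<noteq> 0" unfolding D_def using t_least by fastforce
  \<comment> \<open>The factor is chosen just larger than the constant \<open>D\<close> that
    divisibility allows.\<close>
  obtain m0 where m0: "m0 \<ge> 1"
    "\<And>m. m \<ge> m0 \<Longrightarrow> (\<bar>D\<bar> + 1) * \<bar>?a m\<bar> \<le> \<bar>?a (Suc m)\<bar>"
    using orbit_val_growth_factor[OF d unb, of "\<bar>D\<bar> + 1"] by auto
  have mono: "\<bar>?a m\<bar> \<le> \<bar>?a m'\<bar>" if "m0 \<le> m" "m \<le> m'" for m m'
    using that(2)
  proof (induction m' rule: dec_induct)
    case (step m')
    have "1 * \<bar>?a m'\<bar> \<le> (\<bar>D\<bar> + 1) * \<bar>?a m'\<bar>" by (rule mult_right_mono) auto
    with m0(2)[of m'] step that(1) show ?case by linarith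
  qed simp
  have "\<exists>p. primitive_prime_divisor ?a m p" if m: "m \<ge> m0 + t" for m
  proof (rule ccontr)
    assume no: "\<not> ?thesis"
    have a0: "?a h \<noteq> 0" if "h \<ge> 1" for h
      using rigid_divisibility_seq_nonzero[OF rigid that] .
    have nz: "D * ?a (m - t) \<noteq> 0" using D0 a0[of "m - t"] m m0(1) by auto
    have "?a m dvd D * ?a (m - t)"
    proof (rule dvd_if_prime_power_dvd)
      fix p :: int assume p: "prime p" "p dvd ?a m"
      let ?q = "p ^ multiplicity p (?a m)"
      have "\<not> primitive_prime_divisor ?a m p" using no by simp
      from this p obtain r where r: "1 \<le> r" "r < m" "p dvd ?a r"
        by (rule not_primitive_prime_divisorE)
      define h where "h = m - r"
      show "?q dvd D * ?a (m - t)"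
      proof (cases "?b h = 0")
        case True
        then have "t \<le> h" using t_least r by (simp add: h_def)
        then have "?b h = orbit_val f (?b t) (h - t)" by (simp flip: orbit_val_add)
        then have b: "?b (h - t) = 0" using True t by simp
        \<comment> \<open>One period has been removed from the return to 0, so the congruence now
          ends at index \<open>m - t\<close>. It is enough to work modulo \<open>p\<close>, since
          rigidity restores the full power.\<close>
        have "p dvd orbit_val f (?a r) (h - t) - ?b (h - t)"
          using r by (intro dvd_orbit_val_diff) simp
        moreover have "orbit_val f (?a r) (h - t) = ?a (m - t)"
          using r \<open>t \<le> h\<close> by (simp add: h_def flip: orbit_val_add)
        ultimately have "p dvd ?a (m - t)" using b by simp
        then have "?q dvd ?a (m - t)"
          using rigid_divisibility_seq_prime_power[OF rigid p(1) _ _ _ p(2)] m m0(1) by simp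
        then show ?thesis by simp
      next
        case False
        \<comment> \<open>Reduction modulo the period moves the nonzero value to an index strictly
          between 0 and \<open>t\<close>, hence among the factors of \<open>D\<close>.\<close>
        have "?b (h mod t) = ?b h"
          using funpow_mod_eq[where f = "poly f" and n = t and x = 0 and m = h] t
          by (simp add: orbit_val_def)
        moreover have "h mod t \<noteq> 0"
          using False \<open>?b (h mod t) = ?b h\<close> by (metis funpow_0 orbit_val_def)
        then have "?b (h mod t) dvd D"
          unfolding D_def using t(1) by (intro dvd_prodI) (auto simp: Suc_le_eq)
        moreover have "?q dvd ?b h"
          using rigid_orbit_prime_power[OF rigid p(1) r(3) p(2) r(1,2)] by (simp add: h_def)
        ultimately show ?thesis by (metis dvd_mult2 dvd_trans)
      qed
    qed (use nz a0 m m0(1) in auto)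
    then have "\<bar>?a m\<bar> \<le> \<bar>D\<bar> * \<bar>?a (m - t)\<bar>"
      using nz by (metis abs_mult dvd_imp_le_int)
    also have "\<dots> < (\<bar>D\<bar> + 1) * \<bar>?a (m - t)\<bar>"
      using a0[of "m - t"] m m0(1) by (simp add: algebra_simps)
    \<comment> \<open>One step already gains the factor needed; monotonicity covers the rest of the
      period.\<close>
    also have "\<dots> \<le> \<bar>?a (Suc (m - t))\<bar>" using m m0 by simp
    also have "\<dots> \<le> \<bar>?a m\<bar>" using m t by (intro mono) auto
    finally show False by simp
  qed
  with that show ?thesis by blast
qed

theorem eventually_primitive_prime_divisor:
  assumes "degree f \<ge> 2" "unbounded_seq (orbit_val f x)" "rigid_divisibility_seq (orbit_val f x)"
  shows "\<exists>M. \<forall>m\<ge>M. \<exists>p. primitive_prime_divisor (orbit_val f x) m p"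
proof (cases "\<exists>h\<ge>1. orbit_val f 0 h = 0")
  case True
  with assms show ?thesis by (metis primitive_prime_divisor_periodic)
next
  case False
  with assms show ?thesis by (metis primitive_prime_divisor_nonperiodic)
qed

section \<open>Multiplicative independence and rank\<close>

text \<open>Gaussian elimination without division, one coordinate at a time. Staying inside the ring
  gives integer coefficients, which can later serve as exponents.\<close>

lemma linear_dependence_idom:
  fixes k :: "'l \<Rightarrow> 'i \<Rightarrow> 'a::idom"
  assumes "finite I" "finite L" "card I < card L"
  shows "\<exists>c. (\<exists>l\<in>L. c l \<noteq> 0) \<and> (\<forall>i\<in>I. (\<Sum>l\<in>L. c l * k l i) = 0)"
  using assms
proof (induction I arbitrary: L k rule: finite_induct)
  case empty
  then obtain l where "l \<in> L" by fastforce
  then show ?case by (intro exI[of _ "\<lambda>_. 1"]) auto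
next
  case (insert i I)
  show ?case
  proof (cases "\<forall>l\<in>L. k l i = 0")
    case True
    obtain c where "\<exists>l\<in>L. c l \<noteq> 0" "\<forall>i\<in>I. (\<Sum>l\<in>L. c l * k l i) = 0"
      using insert.IH[of L k] insert.prems insert.hyps by auto
    with True show ?thesis by (intro exI[of _ c]) auto
  next
    case False
    then obtain l0 where l0: "l0 \<in> L" "k l0 i \<noteq> 0" by blast
    \<comment> \<open>Cross-multiplying with the pivot row \<open>l0\<close> makes coordinate
      \<open>i\<close> vanish in every row.\<close>
    define k' where "k' l j = k l0 i * k l j - k l i * k l0 j" for l j
    have "card I < card (L - {l0})"
      using insert.prems insert.hyps l0 by simp
    then obtain c' where c': "\<exists>l\<in>L - {l0}. c' l \<noteq> 0"
      "\<And>j. j \<in> I \<Longrightarrow> (\<Sum>l\<in>L - {l0}. c' l * k' l j) = 0"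
      using insert.IH[of "L - {l0}" k'] insert.prems(1) by auto
    \<comment> \<open>This rewrites a relation among the reduced rows in terms of the original ones.
      The pivot is nonzero, so over a domain a nonzero coefficient survives.\<close>
    define c where
      "c l = (if l = l0 then - (\<Sum>l\<in>L - {l0}. c' l * k l i) else k l0 i * c' l)" for l
    have "(\<Sum>l\<in>L. c l * k l j) = (\<Sum>l\<in>L - {l0}. c' l * k' l j)" for j
    proof -
      have "(\<Sum>l\<in>L. c l * k l j) = c l0 * k l0 j + (\<Sum>l\<in>L - {l0}. c l * k l j)"
        using insert.prems l0 by (simp add: sum.remove)
      also have "\<dots> = (\<Sum>l\<in>L - {l0}. - (c' l * k l i) * k l0 j) +
          (\<Sum>l\<in>L - {l0}. k l0 i * c' l * k l j)"
        by (simp add: c_def sum_distrib_right sum_negf)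
      also have "\<dots> = (\<Sum>l\<in>L - {l0}. c' l * k' l j)"
        by (simp add: k'_def algebra_simps flip: sum.distrib)
      finally show ?thesis .
    qed
    moreover have "(\<Sum>l\<in>L - {l0}. c' l * k' l i) = 0"
      by (simp add: k'_def)
    moreover have "\<exists>l\<in>L. c l \<noteq> 0" using c'(1) l0 by (auto simp: c_def)
    ultimately show ?thesis using c'(2) by (intro exI[of _ c]) auto
  qed
qed

text \<open>The largest index with a nonzero exponent contributes a prime which divides no other
  factor.\<close>

lemma multiplicatively_independent_of_primitive:
  fixes a :: "nat \<Rightarrow> int" and e :: "nat \<Rightarrow> int"
  assumes fin: "finite L" and pos: "\<And>l. l \<in> L \<Longrightarrow> l \<ge> 1"
    and nz: "\<And>l. l \<in> L \<Longrightarrow> a l \<noteq> 0"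
    and prim: "\<And>l. l \<in> L \<Longrightarrow> \<exists>p. primitive_prime_divisor a l p"
    and one: "(\<Prod>l\<in>L. (of_int (a l) :: complex) powi e l) = 1"
    and "l \<in> L"
  shows "e l = 0"
proof (rule ccontr)
  assume "e l \<noteq> 0"
  define S where "S = {l \<in> L. e l \<noteq> 0}"
  have S: "finite S" "S \<noteq> {}" using fin \<open>l \<in> L\<close> \<open>e l \<noteq> 0\<close> by (auto simp: S_def)
  define q where "q = Max S"
  have q: "q \<in> L" "e q \<noteq> 0" and q_max: "\<And>l. l \<in> L \<Longrightarrow> e l \<noteq> 0 \<Longrightarrow> l \<le> q"
    using Max_in[OF S] Max_ge[OF S(1)] by (auto simp: q_def S_def)
  obtain p where p: "prime p" "p dvd a q" "\<And>r. r \<in> {1..<q} \<Longrightarrow> \<not> p dvd a r"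
    using prim[OF q(1)] by (auto simp: primitive_prime_divisor_def)
  \<comment> \<open>Inverting the relation if necessary makes the exponent at \<open>q\<close>
    positive.\<close>
  define g where "g l = sgn (e q) * e l" for l
  have gq: "g q > 0" using q by (auto simp: g_def sgn_if)
  have "(\<Prod>l\<in>L. (of_int (a l) :: complex) powi g l) = 1"
  proof (cases "e q > 0")
    case False
    then have "(\<Prod>l\<in>L. (of_int (a l) :: complex) powi g l) =
        inverse (\<Prod>l\<in>L. (of_int (a l) :: complex) powi e l)"
      using q by (simp add: g_def sgn_if power_int_minus prod_inversef[symmetric] o_def)
    then show ?thesis using one by simp
  qed (use one in \<open>simp add: g_def\<close>)
  \<comment> \<open>Truncation by \<open>nat\<close> separates positive from negative exponents and
    so turns the relation into an equality of two integer products.\<close>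
  moreover have "(of_int (a l) :: complex) powi g l =
      of_int (a l ^ nat (g l)) / of_int (a l ^ nat (- g l))" for l
    by (cases "g l \<ge> 0") (auto simp: power_int_def field_simps)
  ultimately have "of_int (\<Prod>l\<in>L. a l ^ nat (g l)) / of_int (\<Prod>l\<in>L. a l ^ nat (- g l)) = (1::complex)"
    by (simp add: prod_dividef)
  moreover have "(\<Prod>l\<in>L. a l ^ nat (- g l)) \<noteq> 0" using nz fin by simp
  ultimately have "(of_int (\<Prod>l\<in>L. a l ^ nat (g l)) :: complex) = of_int (\<Prod>l\<in>L. a l ^ nat (- g l))"
    by (metis divide_eq_1_iff)
  then have eq: "(\<Prod>l\<in>L. a l ^ nat (g l)) = (\<Prod>l\<in>L. a l ^ nat (- g l))"
    by (simp only: of_int_eq_iff)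
  have "a q dvd a q ^ nat (g q)" using gq by (intro dvd_power) auto
  also have "\<dots> dvd (\<Prod>l\<in>L. a l ^ nat (g l))" using fin q by (intro dvd_prodI) auto
  finally have "p dvd (\<Prod>l\<in>L. a l ^ nat (- g l))" using p eq by (metis dvd_trans)
  then obtain r where r: "r \<in> L" "p dvd a r ^ nat (- g r)"
    using p fin by (auto simp: prime_dvd_prod_iff)
  then have "p dvd a r" "nat (- g r) \<noteq> 0"
    using p by (auto dest: prime_dvd_power intro: ccontr)
  then have "e r \<noteq> 0" "r \<noteq> q" using gq by (auto simp: g_def)
  \<comment> \<open>Since \<open>p\<close> divides a factor with negative exponent, that factor is
    not the one at \<open>q\<close>; by maximality its index is smaller, against
    primitivity.\<close>
  then have "r \<in> {1..<q}" using q_max[OF r(1)] pos[OF r(1)] by auto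
  with p(3) \<open>p dvd a r\<close> show False by blast
qed

text \<open>Each index in \<open>L\<close> puts a power of \<open>a l\<close> into a group of rank at most \<open>card I\<close>, and the
  \<open>a l\<close> are multiplicatively independent.\<close>

lemma card_dependent_le:
  fixes a :: "nat \<Rightarrow> int" and v :: "'i \<Rightarrow> complex"
  assumes fin: "finite L" "finite I"
    and pos: "\<And>l. l \<in> L \<Longrightarrow> l \<ge> 1"
    and nz: "\<And>l. l \<in> L \<Longrightarrow> a l \<noteq> 0"
    and prim: "\<And>l. l \<in> L \<Longrightarrow> \<exists>p. primitive_prime_divisor a l p"
    and v: "\<And>i. i \<in> I \<Longrightarrow> v i \<noteq> 0"
    and dep: "\<And>l. l \<in> L \<Longrightarrow> \<exists>e k. e \<noteq> 0 \<and> of_int (a l) powi e * (\<Prod>i\<in>I. v i powi k i) = 1"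
  shows "card L \<le> card I"
proof (rule ccontr)
  assume card: "\<not> card L \<le> card I"
  obtain e k where ek: "\<And>l. l \<in> L \<Longrightarrow> e l \<noteq> 0"
    "\<And>l. l \<in> L \<Longrightarrow> of_int (a l) powi e l * (\<Prod>i\<in>I. v i powi k l i) = 1"
    using dep by metis
  \<comment> \<open>More exponent vectors than coordinates: the combination \<open>c\<close> cancels
    every \<open>v i\<close> and leaves a relation among the \<open>a l\<close> alone.\<close>
  obtain c :: "nat \<Rightarrow> int" where c: "\<exists>l\<in>L. c l \<noteq> 0" "\<And>i. i \<in> I \<Longrightarrow> (\<Sum>l\<in>L. c l * k l i) = 0"
    using linear_dependence_idom[OF fin(2,1), of k] card by auto
  have powi_sum: "z powi (\<Sum>l\<in>L. g l) = (\<Prod>l\<in>L. z powi g l)"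
    if "z \<noteq> 0" for z :: complex and g :: "nat \<Rightarrow> int"
    using fin(1) by (induction L rule: finite_induct) (auto simp: power_int_add that)
  have powi_prod: "(\<Prod>i\<in>I. g i) powi m = (\<Prod>i\<in>I. g i powi m)"
    for g :: "'i \<Rightarrow> complex" and m
    using fin(2) by (induction I rule: finite_induct) (auto simp: power_int_mult_distrib)
  have "1 = (\<Prod>l\<in>L. (of_int (a l) powi e l * (\<Prod>i\<in>I. v i powi k l i)) powi c l)"
    using ek(2) by simp
  also have "\<dots> = (\<Prod>l\<in>L. of_int (a l) powi (e l * c l)) *
      (\<Prod>l\<in>L. \<Prod>i\<in>I. v i powi (c l * k l i))"
    by (simp add: power_int_mult_distrib powi_prod prod.distrib mult.commute[of "c _"]
        flip: power_int_mult)
  also have "(\<Prod>l\<in>L. \<Prod>i\<in>I. v i powi (c l * k l i)) = (\<Prod>i\<in>I. v i powi (\<Sum>l\<in>L. c l * k l i))"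
    by (subst prod.swap) (simp add: powi_sum v)
  also have "\<dots> = 1" using c(2) by simp
  finally have "(\<Prod>l\<in>L. (of_int (a l) :: complex) powi (e l * c l)) = 1" by simp
  from multiplicatively_independent_of_primitive[OF fin(1) pos nz prim this]
  show False using c(1) ek(1) by auto
qed

section \<open>Counting dependent tuples\<close>

text \<open>Split a tuple into its restriction to \<open>I\<close> and its \<open>j\<close>-th
  coordinate, then sum over the restrictions.\<close>

lemma card_PiE_fibre_le:
  assumes "finite I" "j \<notin> I" "finite A"
    and "\<And>v. v \<in> I \<rightarrow>\<^sub>E A \<Longrightarrow> card {y \<in> A. P (v(j := y))} \<le> B"
  shows "card {m \<in> insert j I \<rightarrow>\<^sub>E A. P m} \<le> card A ^ card I * B"
proof -
  let ?T = "SIGMA v:I \<rightarrow>\<^sub>E A. {y \<in> A. P (v(j := y))}"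
  have fin: "finite (I \<rightarrow>\<^sub>E A)" using assms by (simp add: finite_PiE)
  have "{m \<in> insert j I \<rightarrow>\<^sub>E A. P m} \<subseteq> (\<lambda>(v, y). v(j := y)) ` ?T"
    by (auto simp: PiE_insert_eq image_iff)
  then have "card {m \<in> insert j I \<rightarrow>\<^sub>E A. P m} \<le> card ?T"
    using fin assms(3) by (intro surj_card_le) auto
  also have "\<dots> = (\<Sum>v\<in>I \<rightarrow>\<^sub>E A. card {y \<in> A. P (v(j := y))})"
    using fin assms(3) by simp
  also have "\<dots> \<le> card (I \<rightarrow>\<^sub>E A) * B"
    using sum_bounded_above[of "I \<rightarrow>\<^sub>E A", OF assms(4)] by simp
  finally show ?thesis using assms(1) by (simp add: card_PiE)
qed

theorem theorem1p7:
  fixes n :: nat and F :: "nat \<Rightarrow> int poly" and x :: "nat \<Rightarrow> int"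
  assumes "n \<ge> 1"
    and "\<And>i. i \<in> {1..n} \<Longrightarrow> degree (F i) \<noteq> 1"
    and "\<And>i. i \<in> {1..n} \<Longrightarrow> \<not> is_monomial (F i)"
    and "\<And>i. i \<in> {1..n} \<Longrightarrow> unbounded_seq (orbit_val (F i) (x i))"
    and "\<And>i. i \<in> {1..n} \<Longrightarrow> rigid_divisibility_seq (orbit_val (F i) (x i))"
  shows "\<exists>c::real. c > 0 \<and>
           (\<forall>N::nat. N \<ge> 2 \<longrightarrow> real (M_count n F x N) \<le> c * real N ^ n / ln (real N))"
proof -
  define a where "a i = orbit_val (F i) (x i)" for i
  have nz: "a i m \<noteq> 0" if "i \<in> {1..n}" "m \<ge> 1" for i m
    unfolding a_def by (rule rigid_divisibility_seq_nonzero[OF assms(5)[OF that(1)] that(2)])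
  have "\<exists>M. \<forall>m\<ge>M. \<exists>p. primitive_prime_divisor (a i) m p" if i: "i \<in> {1..n}" for i
  proof -
    have "degree (F i) \<ge> 2"
      using unbounded_orbit_degree_pos[OF assms(4)[OF i]] assms(2)[OF i] by linarith
    then show ?thesis
      unfolding a_def using assms(4,5)[OF i] by (rule eventually_primitive_prime_divisor)
  qed
  then obtain M where M: "\<And>i m. i \<in> {1..n} \<Longrightarrow> m \<ge> M i \<Longrightarrow> \<exists>p. primitive_prime_divisor (a i) m p"
    by metis
  \<comment> \<open>Dependent tuples are sorted by a coordinate \<open>j\<close> carrying a nonzero
    exponent; the resulting sets may overlap.\<close>
  define dep where
    "dep j m \<longleftrightarrow> (\<exists>k::nat \<Rightarrow> int. k j \<noteq> 0 \<and> (\<Prod>i\<in>{1..n}. (of_int (a i (m i)) :: complex) powi k i) = 1)"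
    for j and m :: "nat \<Rightarrow> nat"
  \<comment> \<open>For fixed other coordinates, \<open>M j\<close> accounts for indices too small
    to guarantee a primitive prime divisor, and \<open>n\<close> for the rank bound
    \<open>n - 1\<close>.\<close>
  define c where "c = real (\<Sum>j\<in>{1..n}. M j + n)"
  have fibre: "card {m \<in> {1..n} \<rightarrow>\<^sub>E {1..N}. dep j m} \<le> N ^ (n - 1) * (M j + n)"
    if j: "j \<in> {1..n}" for j N
  proof -
    define I where "I = {1..n} - {j}"
    have I: "finite I" "j \<notin> I" "insert j I = {1..n}" "card I = n - 1"
      using j by (auto simp: I_def)
    have "card {y \<in> {1..N}. dep j (v(j := y))} \<le> M j + n" if v: "v \<in> I \<rightarrow>\<^sub>E {1..N}" for v
    proof -
      \<comment> \<open>Restricting to indices from \<open>M j\<close> on makes the rank bound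
        applicable, with the entries at \<open>v\<close> as fixed generators.\<close>
      define L where "L = {y \<in> {1..N}. M j \<le> y \<and> dep j (v(j := y))}"
      have "card L \<le> card I"
      proof (rule card_dependent_le[of L I "a j" "\<lambda>i. of_int (a i (v i))"])
        fix i assume i: "i \<in> I"
        then have "v i \<ge> 1" using v by (auto simp: PiE_def Pi_def)
        with i show "(of_int (a i (v i)) :: complex) \<noteq> 0" using nz by (auto simp: I_def)
      next
        fix l assume "l \<in> L"
        then obtain k :: "nat \<Rightarrow> int" where k: "k j \<noteq> 0"
          "(\<Prod>i\<in>insert j I. (of_int (a i ((v(j := l)) i)) :: complex) powi k i) = 1"
          by (auto simp: L_def dep_def I(3))
        have "(\<Prod>i\<in>I. (of_int (a i ((v(j := l)) i)) :: complex) powi k i) =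
            (\<Prod>i\<in>I. of_int (a i (v i)) powi k i)"
          using I(2) by (intro prod.cong) auto
        with k I(1,2) show "\<exists>e k. e \<noteq> 0 \<and> of_int (a j l) powi e *
            (\<Prod>i\<in>I. (of_int (a i (v i)) :: complex) powi k i) = 1"
          by auto
      qed (use I(1) nz[OF j] M[OF j] in \<open>auto simp: L_def\<close>)
      have "{y \<in> {1..N}. dep j (v(j := y))} \<subseteq> {..<M j} \<union> L"
        by (auto simp: L_def)
      then have "card {y \<in> {1..N}. dep j (v(j := y))} \<le> card ({..<M j} \<union> L)"
        by (rule card_mono[rotated]) (simp add: L_def)
      also have "\<dots> \<le> M j + card L" using card_Un_le[of "{..<M j}" L] by simp
      also have "\<dots> \<le> M j + n" using \<open>card L \<le> card I\<close> I(4) by simp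
      finally show ?thesis .
    qed
    from card_PiE_fibre_le[OF I(1,2) _ this] show ?thesis using I(3,4) by simp
  qed
  have "real (M_count n F x N) \<le> c * real N ^ n / ln (real N)" if N: "N \<ge> 2" for N
  proof -
    have "{m \<in> {1..n} \<rightarrow>\<^sub>E {1..N}. mult_dependent n (\<lambda>i. of_int (orbit_val (F i) (x i) (m i)))}
        \<subseteq> (\<Union>j\<in>{1..n}. {m \<in> {1..n} \<rightarrow>\<^sub>E {1..N}. dep j m})"
      unfolding mult_dependent_def dep_def a_def by blast
    then have "M_count n F x N \<le> card (\<Union>j\<in>{1..n}. {m \<in> {1..n} \<rightarrow>\<^sub>E {1..N}. dep j m})"
      unfolding M_count_def by (rule card_mono[rotated]) (auto intro!: finite_PiE)
    also have "\<dots> \<le> (\<Sum>j\<in>{1..n}. card {m \<in> {1..n} \<rightarrow>\<^sub>E {1..N}. dep j m})"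
      by (rule card_UN_le) simp
    also have "\<dots> \<le> (\<Sum>j\<in>{1..n}. N ^ (n - 1) * (M j + n))"
      using fibre by (rule sum_mono)
    also have "\<dots> = N ^ (n - 1) * (\<Sum>j\<in>{1..n}. M j + n)" by (rule sum_distrib_left[symmetric])
    finally have "real (M_count n F x N) \<le> real (N ^ (n - 1) * (\<Sum>j\<in>{1..n}. M j + n))"
      by (simp only: of_nat_le_iff)
    also have "\<dots> = c * real N ^ (n - 1)" by (simp add: c_def)
    also have "\<dots> \<le> c * real N ^ n / ln (real N)"
    proof -
      \<comment> \<open>The saving is a full factor \<open>N\<close>, which is at least
        \<open>ln N\<close>.\<close>
      have "ln (real N) > 0" "ln (real N) \<le> real N" using N ln_bound[of "real N"] by auto
      moreover have "real N ^ n = real N ^ (n - 1) * real N"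
        using assms(1) by (metis power_minus_mult less_le_trans zero_less_one)
      moreover have "c \<ge> 0" unfolding c_def by (rule of_nat_0_le_iff)
      ultimately show ?thesis
        by (simp add: pos_le_divide_eq mult.assoc mult_left_mono)
    qed
    finally show ?thesis .
  qed
  moreover have "c > 0"
  proof -
    have "0 < M 1 + n" using assms(1) by simp
    also have "\<dots> \<le> (\<Sum>j\<in>{1..n}. M j + n)" using assms(1) by (intro member_le_sum) auto
    finally show ?thesis unfolding c_def by (simp only: of_nat_0_less_iff)
  qed
  ultimately show ?thesis by blast
qed

end
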